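(* Let $\Phi$ be a finite irreducible crystallographic root system with simple system $\Pi$. There exists some positive real number $r$, with $r<2$, such that $\overline\alpha\in r\cdot\mathcal P_{\Phi_\alpha}$ for all $\alpha\in\Pi$.
   Context: $\Phi$ is reduced, in a Euclidean space $\mathbb E=\mathrm{Span}_{\mathbb R}\Phi$ with Weyl-group-invariant form. For $\alpha\in\Pi$, $\overline\alpha$ is the orthogonal projection of $\alpha$ onto $\mathrm{Span}(\Pi\setminus\{\alpha\})$; $\Phi_\alpha$ is the root subsystem generated by $\Pi\setminus\{\alpha\}$; $\mathcal P_{\Phi_\alpha}$ is its root polytope, i.e. the convex hull of $\Phi_\alpha$, with the convention that it is $\{0\}$ if $\Phi_\alpha=\emptyset$ (rank one case). *)

theory Defs
  imports "HOL-Analysis.Analysis"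
begin

(* The ambient Euclidean space is an arbitrary type of class euclidean_space; its inner
   product is the Weyl-group-invariant form, because every reflection below is an
   isometry of it.  Its dimension is at least 1. *)

definition reflection :: "'a::euclidean_space \<Rightarrow> 'a \<Rightarrow> 'a" where
  "reflection \<alpha> x = x - (2 * (x \<bullet> \<alpha>) / (\<alpha> \<bullet> \<alpha>)) *\<^sub>R \<alpha>"

definition root_system :: "'a::euclidean_space set \<Rightarrow> bool" where
  "root_system \<Phi> \<longleftrightarrow> finite \<Phi> \<and> 0 \<notin> \<Phi> \<and> span \<Phi> = UNIV \<and>
     (\<forall>\<alpha>\<in>\<Phi>. reflection \<alpha> ` \<Phi> = \<Phi>)"

definition crystallographic :: "'a::euclidean_space set \<Rightarrow> bool" where
  "crystallographic \<Phi> \<longleftrightarrow> (\<forall>\<alpha>\<in>\<Phi>. \<forall>\<beta>\<in>\<Phi>. 2 * (\<beta> \<bullet> \<alpha>) / (\<alpha> \<bullet> \<alpha>) \<in> \<int>)"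

definition reduced_roots :: "'a::euclidean_space set \<Rightarrow> bool" where
  "reduced_roots \<Phi> \<longleftrightarrow> (\<forall>\<alpha>\<in>\<Phi>. \<Phi> \<inter> span {\<alpha>} = {\<alpha>, - \<alpha>})"

definition irreducible_roots :: "'a::euclidean_space set \<Rightarrow> bool" where
  "irreducible_roots \<Phi> \<longleftrightarrow> \<Phi> \<noteq> {} \<and>
     \<not> (\<exists>A B. A \<noteq> {} \<and> B \<noteq> {} \<and> A \<union> B = \<Phi> \<and> A \<inter> B = {} \<and>
            (\<forall>a\<in>A. \<forall>b\<in>B. orthogonal a b))"

definition simple_system :: "'a::euclidean_space set \<Rightarrow> 'a set \<Rightarrow> bool" where
  "simple_system \<Phi> \<Delta> \<longleftrightarrow> \<Delta> \<subseteq> \<Phi> \<and> independent \<Delta> \<and> span \<Delta> = UNIV \<and>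
     (\<forall>\<beta>\<in>\<Phi>. \<exists>c::'a \<Rightarrow> int.
        \<beta> = (\<Sum>\<gamma>\<in>\<Delta>. of_int (c \<gamma>) *\<^sub>R \<gamma>) \<and>
        ((\<forall>\<gamma>\<in>\<Delta>. c \<gamma> \<ge> 0) \<or> (\<forall>\<gamma>\<in>\<Delta>. c \<gamma> \<le> 0)))"

definition root_subsystem :: "'a::euclidean_space set \<Rightarrow> 'a set \<Rightarrow> bool" where
  "root_subsystem \<Phi> \<Psi> \<longleftrightarrow> \<Psi> \<subseteq> \<Phi> \<and> (\<forall>\<alpha>\<in>\<Psi>. reflection \<alpha> ` \<Psi> = \<Psi>)"

(* The smallest root subsystem containing S; it is empty when S is empty. *)
definition generated_subsystem :: "'a::euclidean_space set \<Rightarrow> 'a set \<Rightarrow> 'a set" where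
  "generated_subsystem \<Phi> S = root_subsystem \<Phi> hull S"

definition root_polytope :: "'a::euclidean_space set \<Rightarrow> 'a set" where
  "root_polytope \<Psi> = (if \<Psi> = {} then {0} else convex hull \<Psi>)"

definition orth_proj :: "'a::euclidean_space set \<Rightarrow> 'a \<Rightarrow> 'a" where
  "orth_proj V x = (THE y. y \<in> V \<and> (\<forall>v\<in>V. orthogonal (x - y) v))"

lemma orth_proj_exists1:
  fixes x :: "'a::euclidean_space"
  assumes "subspace V"
  shows "\<exists>!y. y \<in> V \<and> (\<forall>v\<in>V. orthogonal (x - y) v)"
proof -
  have V: "span V = V" using assms by (simp add: span_eq_iff)
  obtain y z where yz: "y \<in> V" "\<And>w. w \<in> V \<Longrightarrow> orthogonal z w" "x = y + z"
    using orthogonal_subspace_decomp_exists[of V x] unfolding V by metis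
  show ?thesis
  proof (rule ex1I[of _ y])
    show "y \<in> V \<and> (\<forall>v\<in>V. orthogonal (x - y) v)" using yz by simp
  next
    fix y' assume y': "y' \<in> V \<and> (\<forall>v\<in>V. orthogonal (x - y') v)"
    have d: "y' - y \<in> V" using assms y' yz(1) by (blast intro: subspace_diff)
    have "(x - y) \<bullet> (y' - y) = 0" "(x - y') \<bullet> (y' - y) = 0"
      using d y' yz by (auto simp: orthogonal_def)
    then have "(y' - y) \<bullet> (y' - y) = 0" by (simp add: inner_diff_left)
    then show "y' = y" by simp
  qed
qed

lemma orth_proj:
  fixes x :: "'a::euclidean_space"
  assumes "subspace V"
  shows "orth_proj V x \<in> V" and "v \<in> V \<Longrightarrow> orthogonal (x - orth_proj V x) v"
  using theI'[OF orth_proj_exists1[OF assms, of x]] unfolding orth_proj_def by blast+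

end

theory Submission
  imports Defs
begin

text \<open>
  Write \<open>- \<alpha>' = (\<Sum>\<beta>. c \<beta> \<beta>)\<close> for the projection \<open>\<alpha>'\<close> of \<open>\<alpha>\<close>, summing over the other simple roots;
  all \<open>c \<beta>\<close> are nonnegative because simple roots form obtuse angles. Let \<open>J\<close> be the set of simple
  roots orthogonal to \<open>\<alpha>\<close>. For a neighbour \<open>\<beta>\<close> of \<open>\<alpha>\<close>, the centroid \<open>a \<beta>\<close> of the roots of the
  subsystem lying in \<open>\<beta> + span J\<close> is fixed by the reflections in \<open>J\<close>, hence orthogonal to \<open>J\<close>.
  Since \<open>\<alpha>'\<close> is orthogonal to \<open>J\<close> as well, \<open>- \<alpha>' = (\<Sum>\<beta>. c \<beta> a \<beta>)\<close> over the neighbours, so \<open>\<alpha>'\<close> lies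
  in \<open>t\<close> times the root polytope for \<open>t = (\<Sum>\<beta>. c \<beta>)\<close>. By integrality
  \<open>- (\<beta> \<bullet> \<alpha>) \<ge> (\<alpha> \<bullet> \<alpha>) / 2\<close> for every neighbour, whence
  \<open>t (\<alpha> \<bullet> \<alpha>) / 2 \<le> - (\<Sum>\<beta>. c \<beta> (\<beta> \<bullet> \<alpha>)) = \<alpha>' \<bullet> \<alpha>' < \<alpha> \<bullet> \<alpha>\<close>.
\<close>

lemma linear_reflection: "linear (reflection \<alpha>)"
  by (rule linearI)
     (auto simp: reflection_def algebra_simps inner_add_left add_divide_distrib scaleR_add_left)

lemma reflection_self: "reflection \<alpha> \<alpha> = - \<alpha>"
  by (cases "\<alpha> = 0") (auto simp: reflection_def scaleR_2)

lemma reflection_reflection: "reflection \<alpha> (reflection \<alpha> x) = x"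
  by (cases "\<alpha> = 0")
     (auto simp: reflection_def inner_diff_left algebra_simps simp flip: scaleR_add_left)

lemma inj_reflection: "inj (reflection \<alpha>)"
  by (metis injI reflection_reflection)

lemma reflection_fixed_iff: "reflection \<alpha> x = x \<longleftrightarrow> orthogonal x \<alpha>"
  by (auto simp: reflection_def orthogonal_def)

lemma generated_subsystem_subset:
  assumes "root_system \<Phi>" "S \<subseteq> \<Phi>"
  shows "generated_subsystem \<Phi> S \<subseteq> \<Phi>"
  unfolding generated_subsystem_def
  by (rule hull_minimal) (use assms in \<open>auto simp: root_system_def root_subsystem_def\<close>)

lemma reflection_generated_subsystem:
  assumes "\<beta> \<in> generated_subsystem \<Phi> S" "\<gamma> \<in> generated_subsystem \<Phi> S"
  shows "reflection \<beta> \<gamma> \<in> generated_subsystem \<Phi> S"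
  using assms unfolding generated_subsystem_def hull_def root_subsystem_def by blast

text \<open>A reflection in \<open>j\<close> changes a vector by a multiple of \<open>j\<close>, so
  it maps the finite slice of \<Psi> in the coset of \<beta> modulo \<open>span J\<close>
  injectively into itself. It therefore permutes the slice and fixes its average.\<close>

lemma orthogonal_centroid:
  assumes "finite \<Psi>" and closed: "\<And>\<beta> \<gamma>. \<beta> \<in> \<Psi> \<Longrightarrow> \<gamma> \<in> \<Psi> \<Longrightarrow> reflection \<beta> \<gamma> \<in> \<Psi>"
    and "J \<subseteq> \<Psi>" "\<beta> \<in> \<Psi>"
  obtains a where "a \<in> convex hull \<Psi>" "a - \<beta> \<in> span J" "\<And>j. j \<in> J \<Longrightarrow> orthogonal a j"
proof
  define S where "S = {\<gamma>\<in>\<Psi>. \<gamma> - \<beta> \<in> span J}"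
  define a where "a = (\<Sum>\<gamma>\<in>S. (1 / card S) *\<^sub>R \<gamma>)"
  have S: "finite S" "S \<subseteq> \<Psi>" "\<beta> \<in> S"
    using assms by (auto simp: S_def span_zero)
  then have card: "(\<Sum>\<gamma>\<in>S. 1 / card S) = (1::real)"
    by auto
  show "a \<in> convex hull \<Psi>"
    unfolding a_def using S card
    by (intro convex_sum) (auto simp: hull_inc)
  \<comment> \<open>The weights sum to 1, so \<beta> can be subtracted inside the average.\<close>
  have "a - \<beta> = (\<Sum>\<gamma>\<in>S. (1 / card S) *\<^sub>R (\<gamma> - \<beta>))"
    by (simp only: a_def scaleR_diff_right sum_subtractf scaleR_left.sum[symmetric] card) simp
  also have "\<dots> \<in> span J"
    by (intro span_sum span_scale) (auto simp: S_def)
  finally show "a - \<beta> \<in> span J" .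
  fix j assume j: "j \<in> J"
  have "reflection j \<gamma> \<in> S" if "\<gamma> \<in> S" for \<gamma>
  proof -
    have "reflection j \<gamma> - \<beta> = (\<gamma> - \<beta>) - (2 * (\<gamma> \<bullet> j) / (j \<bullet> j)) *\<^sub>R j"
      by (simp add: reflection_def)
    also have "\<dots> \<in> span J"
      using that unfolding S_def by (blast intro: span_diff span_scale span_base j)
    finally show ?thesis
      using that j assms by (auto simp: S_def)
  qed
  then have im: "reflection j ` S = S"
    using S inj_reflection by (intro endo_inj_surj) (auto intro: inj_on_subset)
  have "reflection j a = (\<Sum>\<gamma>\<in>S. (1 / card S) *\<^sub>R reflection j \<gamma>)"
    by (simp add: a_def linear_sum[OF linear_reflection] linear_cmul[OF linear_reflection])
  also have "\<dots> = (\<Sum>\<gamma>\<in>reflection j ` S. (1 / card S) *\<^sub>R \<gamma>)"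
    by (subst sum.reindex) (auto intro: inj_on_subset[OF inj_reflection])
  also have "\<dots> = a"
    by (simp add: im a_def)
  finally show "orthogonal a j"
    by (simp add: reflection_fixed_iff)
qed

text \<open>The root \<beta> - n \<alpha> obtained by reflecting \<beta> has coefficient 1 at
  \<beta>. All its coefficients share a sign, so the coefficient -n at \<alpha> is nonnegative
  too.\<close>

lemma simple_roots_obtuse:
  assumes "root_system \<Phi>" "simple_system \<Phi> \<Delta>" "\<alpha> \<in> \<Delta>" "\<beta> \<in> \<Delta>" "\<alpha> \<noteq> \<beta>"
  shows "\<beta> \<bullet> \<alpha> \<le> 0"
proof -
  have ind: "independent \<Delta>" and sub: "\<Delta> \<subseteq> \<Phi>" and fin: "finite \<Delta>"
    using assms(2) by (auto simp: simple_system_def independent_imp_finite)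
  have "\<alpha> \<noteq> 0"
    using assms(1,3) sub by (auto simp: root_system_def)
  define n where "n = 2 * (\<beta> \<bullet> \<alpha>) / (\<alpha> \<bullet> \<alpha>)"
  have "reflection \<alpha> \<beta> \<in> \<Phi>"
    using assms(1,3,4) sub unfolding root_system_def by blast
  then obtain c :: "'a \<Rightarrow> int" where c: "reflection \<alpha> \<beta> = (\<Sum>\<gamma>\<in>\<Delta>. of_int (c \<gamma>) *\<^sub>R \<gamma>)"
    "(\<forall>\<gamma>\<in>\<Delta>. c \<gamma> \<ge> 0) \<or> (\<forall>\<gamma>\<in>\<Delta>. c \<gamma> \<le> 0)"
    using assms(2) unfolding simple_system_def by blast
  \<comment> \<open>\<open>d\<close> is the difference between two expansions of the same root, the
    integral one given by \<open>c\<close> and \<beta> - n \<alpha>. Independence forces it to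
    vanish.\<close>
  define d where "d \<gamma> = of_int (c \<gamma>) - (if \<gamma> = \<beta> then 1 else 0) + (if \<gamma> = \<alpha> then n else 0)" for \<gamma>
  have "(\<Sum>\<gamma>\<in>\<Delta>. d \<gamma> *\<^sub>R \<gamma>) = reflection \<alpha> \<beta> - \<beta> + n *\<^sub>R \<alpha>"
    using assms(3,4) fin
    by (simp add: d_def c(1) scaleR_add_left scaleR_diff_left sum.distrib sum_subtractf
        if_distrib[of "\<lambda>x. x *\<^sub>R _"] cong: if_cong)
  also have "\<dots> = 0"
    by (simp add: reflection_def n_def)
  finally have d: "d \<gamma> = 0" if "\<gamma> \<in> \<Delta>" for \<gamma>
    using ind fin that by (auto simp: independent_explicit)
  have "c \<beta> = 1" "of_int (c \<alpha>) = - n"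
    using d[OF assms(4)] d[OF assms(3)] assms(5) by (auto simp: d_def)
  then have "n \<le> 0"
    using c(2) assms(3,4) by force
  then show ?thesis
    using \<open>\<alpha> \<noteq> 0\<close> by (simp add: n_def divide_le_0_iff flip: inner_gt_zero_iff)
qed

text \<open>Let \<open>p\<close> and \<open>u\<close> collect the positive and negative parts of the
  coefficients. Obtuseness gives p \<bullet> u \<le> 0 and \<open>dom\<close> gives (p - u)
  \<bullet> u \<ge> 0, so u \<bullet> u \<le> 0 and \<open>u\<close> vanishes.\<close>

lemma obtuse_coeff_nonneg:
  fixes B :: "'a::euclidean_space set"
  assumes ind: "independent B"
    and obtuse: "\<And>a b. a \<in> B \<Longrightarrow> b \<in> B \<Longrightarrow> a \<noteq> b \<Longrightarrow> a \<bullet> b \<le> 0"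
    and dom: "\<And>b. b \<in> B \<Longrightarrow> 0 \<le> (\<Sum>a\<in>B. c a *\<^sub>R a) \<bullet> b"
    and "b \<in> B"
  shows "0 \<le> c b"
proof -
  have fin: "finite B"
    using ind by (rule independent_imp_finite)
  define u where "u = (\<Sum>b\<in>B. max 0 (- c b) *\<^sub>R b)"
  define p where "p = (\<Sum>b\<in>B. max 0 (c b) *\<^sub>R b)"
  have x: "(\<Sum>a\<in>B. c a *\<^sub>R a) = p - u"
    unfolding p_def u_def sum_subtractf[symmetric] scaleR_diff_left[symmetric]
    by (intro sum.cong) auto
  have "0 \<le> (\<Sum>a\<in>B. c a *\<^sub>R a) \<bullet> u"
    unfolding u_def inner_sum_right inner_scaleR_right
    by (intro sum_nonneg mult_nonneg_nonneg dom) auto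
  then have "0 \<le> (p - u) \<bullet> u"
    by (simp only: x)
  moreover have "p \<bullet> u \<le> 0"
  proof -
    have "p \<bullet> u = (\<Sum>a\<in>B. \<Sum>b\<in>B. max 0 (c a) * (max 0 (- c b) * (a \<bullet> b)))"
      by (simp only: p_def u_def inner_sum_left inner_scaleR_left)
         (simp only: inner_sum_right inner_scaleR_right sum_distrib_left)
    \<comment> \<open>On the diagonal, where a \<bullet> a is not obtuse, one of the two maxima is
      0.\<close>
    moreover have "max 0 (c a) * (max 0 (- c b) * (a \<bullet> b)) \<le> 0" if "a \<in> B" "b \<in> B" for a b
      using obtuse[of a b] that by (cases "a = b") (auto simp: max_def mult_le_0_iff)
    ultimately show ?thesis
      by (simp add: sum_nonpos)
  qed
  ultimately have "u \<bullet> u \<le> 0"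
    by (simp add: inner_diff_left)
  then have "u = 0"
    using inner_gt_zero_iff[of u] by linarith
  then have "max 0 (- c b) = 0"
    using ind fin \<open>b \<in> B\<close> unfolding independent_explicit u_def
    by (auto dest: spec[of _ "\<lambda>b. max 0 (- c b)"])
  then show ?thesis
    by linarith
qed

text \<open>Dilates of a convex set containing 0 are nested. This allows the factors found for the
  individual simple roots to be replaced by one common factor.\<close>

lemma convex_scaled_mono:
  assumes "convex P" "0 \<in> P" "0 \<le> s" "s \<le> r" "x \<in> (\<lambda>x. s *\<^sub>R x) ` P"
  shows "x \<in> (\<lambda>x. r *\<^sub>R x) ` P"
proof (cases "r = 0")
  case True
  then show ?thesis using assms by force
next
  case False
  obtain y where y: "y \<in> P" "x = s *\<^sub>R y" using assms by blast
  have "(1 - s / r) *\<^sub>R 0 + (s / r) *\<^sub>R y \<in> P"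
    using assms y False by (intro convexD) auto
  moreover have "x = r *\<^sub>R ((1 - s / r) *\<^sub>R 0 + (s / r) *\<^sub>R y)"
    using False y by simp
  ultimately show ?thesis by blast
qed

text \<open>Dividing by the total weight gives a convex combination. If the total weight is 0, every
  term vanishes and 0 \<in> P suffices.\<close>

lemma convex_sum_scaled:
  assumes "convex P" "0 \<in> P" "finite I" "\<And>i. i \<in> I \<Longrightarrow> 0 \<le> c i" "\<And>i. i \<in> I \<Longrightarrow> y i \<in> P"
  shows "(\<Sum>i\<in>I. c i *\<^sub>R y i) \<in> (\<lambda>x. sum c I *\<^sub>R x) ` P"
proof (cases "sum c I = 0")
  case True
  then have "\<forall>i\<in>I. c i = 0"
    using assms by (simp add: sum_nonneg_eq_0_iff)
  then show ?thesis
    using True assms by force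
next
  case False
  have "(\<Sum>i\<in>I. (c i / sum c I) *\<^sub>R y i) \<in> P"
    using assms False
    by (intro convex_sum) (auto simp: sum_nonneg simp flip: sum_divide_distrib)
  moreover have "(\<Sum>i\<in>I. c i *\<^sub>R y i) = sum c I *\<^sub>R (\<Sum>i\<in>I. (c i / sum c I) *\<^sub>R y i)"
    using False by (simp add: scaleR_sum_right)
  ultimately show ?thesis by blast
qed

lemma zero_in_convex_hull_symmetric:
  assumes "x \<in> \<Psi>" "- x \<in> \<Psi>"
  shows "0 \<in> convex hull \<Psi>"
proof -
  have "(1/2) *\<^sub>R x + (1/2) *\<^sub>R (- x) \<in> convex hull \<Psi>"
    using assms by (intro convexD) (auto simp: hull_inc)
  then show ?thesis by simp
qed

lemma convex_root_polytope: "convex (root_polytope \<Psi>)"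
  by (simp add: root_polytope_def)

lemma zero_in_root_polytope:
  assumes "\<And>\<gamma>. \<gamma> \<in> \<Psi> \<Longrightarrow> - \<gamma> \<in> \<Psi>"
  shows "0 \<in> root_polytope \<Psi>"
  using assms zero_in_convex_hull_symmetric by (auto simp: root_polytope_def)

text \<open>The nonnegative combination of centroids represents -\<alpha>', so the centroids have to
  be negated to reach \<alpha>' itself.\<close>

lemma uminus_root_polytope:
  assumes sym: "\<And>\<gamma>. \<gamma> \<in> \<Psi> \<Longrightarrow> - \<gamma> \<in> \<Psi>" and "x \<in> convex hull \<Psi>"
  shows "- x \<in> root_polytope \<Psi>"
proof -
  have "uminus ` \<Psi> = \<Psi>"
    using sym by force
  moreover have "- x \<in> convex hull (uminus ` \<Psi>)"
    using assms(2) convex_hull_linear_image[of uminus \<Psi>] by (auto simp: linear_uminus)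
  ultimately show ?thesis
    using assms(2) by (auto simp: root_polytope_def)
qed

lemma orth_proj_in_scaled_polytope:
  fixes \<Phi> \<Delta> :: "'a::euclidean_space set"
  assumes rs: "root_system \<Phi>" and cryst: "crystallographic \<Phi>" and ss: "simple_system \<Phi> \<Delta>"
    and \<alpha>: "\<alpha> \<in> \<Delta>"
  defines "\<Psi> \<equiv> generated_subsystem \<Phi> (\<Delta> - {\<alpha>})"
  obtains t where "0 \<le> t" "t < 2"
    "orth_proj (span (\<Delta> - {\<alpha>})) \<alpha> \<in> (\<lambda>x. t *\<^sub>R x) ` root_polytope \<Psi>"
proof -
  define B where "B = \<Delta> - {\<alpha>}"
  define J where "J = {\<beta>\<in>B. \<beta> \<bullet> \<alpha> = 0}"
  define N where "N = {\<beta>\<in>B. \<beta> \<bullet> \<alpha> \<noteq> 0}"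
  \<comment> \<open>\<open>q\<close> is the \<alpha>' of the overview, and \<open>N\<close> is the
    set of neighbours of \<alpha> in the Dynkin diagram.\<close>
  define q where "q = orth_proj (span B) \<alpha>"
  have ind: "independent \<Delta>" and sub: "\<Delta> \<subseteq> \<Phi>" and fin: "finite \<Delta>"
    using ss by (auto simp: simple_system_def independent_imp_finite)
  have indB: "independent B" and finB: "finite B"
    using independent_mono[OF ind, of B] fin by (auto simp: B_def)
  have "\<alpha> \<noteq> 0"
    using rs \<alpha> sub by (auto simp: root_system_def)
  have B\<Psi>: "B \<subseteq> \<Psi>"
    unfolding \<Psi>_def B_def generated_subsystem_def by (rule hull_subset)
  have "\<Psi> \<subseteq> \<Phi>"
    unfolding \<Psi>_def using rs sub by (intro generated_subsystem_subset) auto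
  then have fin\<Psi>: "finite \<Psi>"
    using rs finite_subset by (auto simp: root_system_def)
  have closed: "reflection \<beta> \<gamma> \<in> \<Psi>" if "\<beta> \<in> \<Psi>" "\<gamma> \<in> \<Psi>" for \<beta> \<gamma>
    using that reflection_generated_subsystem unfolding \<Psi>_def by blast
  then have sym: "- \<gamma> \<in> \<Psi>" if "\<gamma> \<in> \<Psi>" for \<gamma>
    using that reflection_self by metis
  have q: "q \<in> span B" "\<And>v. v \<in> span B \<Longrightarrow> q \<bullet> v = \<alpha> \<bullet> v"
    using orth_proj[OF subspace_span[of B], where x = \<alpha>]
    by (auto simp: q_def orthogonal_def inner_diff_left)
  have "\<exists>c. - q = (\<Sum>b\<in>B. c b *\<^sub>R b)"
    using q(1) span_neg[of q B] span_finite[OF finB] by auto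
  then obtain c where c: "- q = (\<Sum>b\<in>B. c b *\<^sub>R b)" by blast
  have obtuse: "a \<bullet> b \<le> 0" if "a \<in> \<Delta>" "b \<in> \<Delta>" "a \<noteq> b" for a b
    using simple_roots_obtuse[OF rs ss] that by blast
  have c0: "0 \<le> c b" if "b \<in> B" for b
  proof (rule obtuse_coeff_nonneg[OF indB _ _ that])
    show "a \<bullet> b \<le> 0" if "a \<in> B" "b \<in> B" "a \<noteq> b" for a b
      using obtuse that by (auto simp: B_def)
    show "0 \<le> (\<Sum>a\<in>B. c a *\<^sub>R a) \<bullet> b" if "b \<in> B" for b
    proof -
      have "\<alpha> \<bullet> b \<le> 0"
        using obtuse[of \<alpha> b] \<alpha> that by (auto simp: B_def)
      then show ?thesis
        using q(2)[OF span_base[OF that]] by (simp add: c[symmetric])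
    qed
  qed
  have "\<forall>b\<in>N. \<exists>a. a \<in> convex hull \<Psi> \<and> a - b \<in> span J \<and> (\<forall>j\<in>J. orthogonal a j)"
  proof
    fix b assume "b \<in> N"
    then have "b \<in> \<Psi>" "J \<subseteq> \<Psi>" using B\<Psi> by (auto simp: N_def J_def)
    then show "\<exists>a. a \<in> convex hull \<Psi> \<and> a - b \<in> span J \<and> (\<forall>j\<in>J. orthogonal a j)"
      using orthogonal_centroid[OF fin\<Psi> closed, of J b] by metis
  qed
  then obtain a where a: "\<And>b. b \<in> N \<Longrightarrow> a b \<in> convex hull \<Psi>"
    "\<And>b. b \<in> N \<Longrightarrow> a b - b \<in> span J" "\<And>b j. b \<in> N \<Longrightarrow> j \<in> J \<Longrightarrow> orthogonal (a b) j"
    by metis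
  have split: "(\<Sum>b\<in>B. f b) = (\<Sum>b\<in>N. f b) + (\<Sum>b\<in>J. f b)"
    for f :: "'a \<Rightarrow> 'b::comm_monoid_add"
    using finB by (subst sum.union_disjoint[symmetric]) (auto simp: N_def J_def intro: sum.cong)
  \<comment> \<open>\<open>w\<close> is the error made by dropping the terms from \<open>J\<close>
    and replacing each neighbour by its centroid. It lies in \<open>span J\<close> and is orthogonal
    to \<open>J\<close>, hence is 0.\<close>
  define w where "w = - q - (\<Sum>b\<in>N. c b *\<^sub>R a b)"
  have "w = (\<Sum>b\<in>J. c b *\<^sub>R b) - (\<Sum>b\<in>N. c b *\<^sub>R (a b - b))"
    by (simp add: w_def c split scaleR_diff_right sum_subtractf)
  also have "\<dots> \<in> span J"
    by (intro span_diff[OF span_sum span_sum] span_scale a(2) span_base)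
  finally have "w \<in> span J" .
  moreover have "orthogonal w j" if "j \<in> J" for j
  proof -
    have "j \<in> B" "\<alpha> \<bullet> j = 0"
      using that by (auto simp: J_def inner_commute)
    then have "q \<bullet> j = 0"
      using q(2)[OF span_base] by simp
    then show ?thesis
      using a(3)[OF _ that]
      by (simp add: w_def orthogonal_def inner_diff_left inner_sum_left)
  qed
  ultimately have "orthogonal w w"
    using orthogonal_to_span by blast
  then have "q = (\<Sum>b\<in>N. c b *\<^sub>R (- a b))"
    by (simp add: w_def orthogonal_self sum_negf algebra_simps)
       (metis add.commute add.inverse_inverse neg_eq_iff_add_eq_0)
  moreover have "(\<Sum>b\<in>N. c b *\<^sub>R (- a b)) \<in> (\<lambda>x. sum c N *\<^sub>R x) ` root_polytope \<Psi>"
    using finB c0 a(1) sym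
    by (intro convex_sum_scaled convex_root_polytope zero_in_root_polytope uminus_root_polytope)
       (auto simp: N_def)
  ultimately have mem: "q \<in> (\<lambda>x. sum c N *\<^sub>R x) ` root_polytope \<Psi>"
    by simp
  have nbr: "\<alpha> \<bullet> \<alpha> / 2 \<le> - (b \<bullet> \<alpha>)" if "b \<in> N" for b
  proof -
    have "b \<in> \<Delta>" "b \<noteq> \<alpha>" "b \<bullet> \<alpha> \<noteq> 0"
      using that by (auto simp: N_def B_def)
    then have neg: "b \<bullet> \<alpha> < 0"
      using obtuse[of b \<alpha>] \<alpha> by simp
    have "2 * (b \<bullet> \<alpha>) / (\<alpha> \<bullet> \<alpha>) \<in> \<int>"
      using cryst \<open>b \<in> \<Delta>\<close> \<alpha> sub by (auto simp: crystallographic_def)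
    then obtain k :: int where k: "2 * (b \<bullet> \<alpha>) / (\<alpha> \<bullet> \<alpha>) = k"
      by (auto elim: Ints_cases)
    have "real_of_int k < 0"
      using neg \<open>\<alpha> \<noteq> 0\<close> by (simp add: k[symmetric] divide_less_0_iff)
    \<comment> \<open>A negative integer is at most -1; this gap is the source of the constant
      2.\<close>
    then have "real_of_int k \<le> real_of_int (- 1)"
      by (simp only: of_int_less_0_iff of_int_le_iff)
    then show ?thesis
      using \<open>\<alpha> \<noteq> 0\<close> by (simp add: k[symmetric] field_simps flip: inner_gt_zero_iff)
  qed
  have "sum c N * (\<alpha> \<bullet> \<alpha> / 2) \<le> (\<Sum>b\<in>N. c b * - (b \<bullet> \<alpha>))"
    unfolding sum_distrib_right using nbr c0
    by (intro sum_mono mult_left_mono) (auto simp: N_def)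
  \<comment> \<open>Pairing the expansion of -q with \<alpha> kills exactly the terms from
    \<open>J\<close>.\<close>
  also have "\<dots> = q \<bullet> \<alpha>"
  proof -
    have "q \<bullet> \<alpha> = - ((- q) \<bullet> \<alpha>)" by simp
    also have "\<dots> = - (\<Sum>b\<in>B. c b * (b \<bullet> \<alpha>))"
      unfolding c by (simp add: inner_sum_left)
    also have "\<dots> = (\<Sum>b\<in>N. c b * - (b \<bullet> \<alpha>))"
      by (simp add: split sum_negf J_def)
    finally show ?thesis ..
  qed
  \<comment> \<open>Since q \<bullet> \<alpha> = q \<bullet> q, the gap is the squared length of
    \<alpha> - q. It is positive because \<alpha> is not in \<open>span B\<close>, which makes the
    bound strict.\<close>
  also have "q \<bullet> \<alpha> < \<alpha> \<bullet> \<alpha>"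
  proof -
    have "\<alpha> \<notin> span B"
      using ind \<alpha> by (auto simp: B_def dependent_def)
    then have "0 < (\<alpha> - q) \<bullet> (\<alpha> - q)"
      using q(1) by auto
    then show ?thesis
      using q(2)[OF q(1)] by (simp add: inner_diff inner_commute)
  qed
  finally have "sum c N < 2"
    using \<open>\<alpha> \<noteq> 0\<close> by (simp add: field_simps)
  moreover have "0 \<le> sum c N"
    using c0 by (intro sum_nonneg) (auto simp: N_def)
  ultimately show thesis
    using that mem unfolding q_def B_def by blast
qed

theorem lemma7p2:
  fixes \<Phi> \<Delta> :: "'a::euclidean_space set"
  assumes "root_system \<Phi>" and "crystallographic \<Phi>" and "reduced_roots \<Phi>"
    and "irreducible_roots \<Phi>" and "simple_system \<Phi> \<Delta>"
  shows "\<exists>r::real. 0 < r \<and> r < 2 \<and>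
    (\<forall>\<alpha>\<in>\<Delta>. orth_proj (span (\<Delta> - {\<alpha>})) \<alpha> \<in>
       (\<lambda>x. r *\<^sub>R x) ` root_polytope (generated_subsystem \<Phi> (\<Delta> - {\<alpha>})))"
proof -
  let ?P = "\<lambda>\<alpha>. root_polytope (generated_subsystem \<Phi> (\<Delta> - {\<alpha>}))"
  have "\<forall>\<alpha>\<in>\<Delta>. \<exists>t\<ge>0. t < 2 \<and> orth_proj (span (\<Delta> - {\<alpha>})) \<alpha> \<in> (\<lambda>x. t *\<^sub>R x) ` ?P \<alpha>"
    using orth_proj_in_scaled_polytope[OF assms(1,2,5)] by metis
  then obtain t where t: "\<And>\<alpha>. \<alpha> \<in> \<Delta> \<Longrightarrow> 0 \<le> t \<alpha> \<and> t \<alpha> < 2 \<and>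
      orth_proj (span (\<Delta> - {\<alpha>})) \<alpha> \<in> (\<lambda>x. t \<alpha> *\<^sub>R x) ` ?P \<alpha>"
    by metis
  \<comment> \<open>Inserting 1 keeps \<open>r\<close> positive even if every
    \<open>t \<alpha>\<close> is 0; finiteness of \<Delta> keeps the maximum strictly below
    2.\<close>
  define r where "r = Max (insert 1 (t ` \<Delta>))"
  have fin: "finite \<Delta>"
    using assms(5) by (auto simp: simple_system_def independent_imp_finite)
  have "1 \<le> r" "r < 2" and le: "\<And>\<alpha>. \<alpha> \<in> \<Delta> \<Longrightarrow> t \<alpha> \<le> r"
    using fin t by (auto simp: r_def)
  moreover have "orth_proj (span (\<Delta> - {\<alpha>})) \<alpha> \<in> (\<lambda>x. r *\<^sub>R x) ` ?P \<alpha>" if "\<alpha> \<in> \<Delta>" for \<alpha>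
  proof (rule convex_scaled_mono[where s = "t \<alpha>"])
    have "- \<gamma> \<in> generated_subsystem \<Phi> (\<Delta> - {\<alpha>})"
      if "\<gamma> \<in> generated_subsystem \<Phi> (\<Delta> - {\<alpha>})" for \<gamma>
      using reflection_generated_subsystem[OF that that] by (simp add: reflection_self)
    then show "0 \<in> ?P \<alpha>"
      by (rule zero_in_root_polytope)
  qed (use t[OF that] le[OF that] in \<open>auto simp: convex_root_polytope\<close>)
  ultimately show ?thesis
    by (intro exI[of _ r]) auto
qed

end
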